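(* Let $\lambda>0$, $\delta=1/M$ with $M\ge 2$ an integer, $\varphi\in(0,2\pi]$, $\alpha>2$, $P_t,\mathcal G_m,\ell,\kappa,\sigma>0$, and $\mathsf P_{\mathsf{fa}}\in(0,1)$. Consider the planar radar network described in the context, in the no-fading case, with the cone antenna pattern and with the aggregate interference replaced by the power $\mathcal I_s$ of the strongest interferer. Let $\Theta>0$ be the detection threshold achieving false alarm probability $\mathsf P_{\mathsf{fa}}$, i.e. solving $\mathsf P_{\mathsf{fa}}=1-F_{\mathcal I_s}(\Theta)^{M-1}$ with $F_{\mathcal I_s}(i)=\mathbb P\{\mathcal I_s\le i\}$. Then the critical target distance $d_{\mathsf m}$, i.e. the distance $d>0$ at which the echo power $\mathcal S=\frac{P_t\,\mathcal G_m^2\,\kappa\,\sigma\,\ell}{4\pi}\,d^{-2\alpha}$ equals $\Theta$, is $$d_{\mathsf m}=\left(\frac{\kappa\sigma}{4\pi}\right)^{\frac{1}{2\alpha}}\left(\frac{-4\pi\ln(1-\mathsf P_{\mathsf{fa}})}{(1-\delta)\,\lambda\,\varphi^2}\right)^{\frac14}.$$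
   Context: Network model. Radar devices are located at the points of a homogeneous Poisson point process (PPP) $\Phi=\{\mathbf x_i\}$ of intensity $\lambda$ on $\mathbb R^2$. Time is slotted. Each device carries an independent mark $m_i$ uniform on $\{0,\dots,M-1\}$ and transmits a pulse exactly in the slots $m_i+kM$, $k\in\mathbb N$. The typical node (the receiver) is located at the origin, in addition to the points of $\Phi$; in each cycle of $M$ slots it transmits in one slot and listens in the other $M-1$ slots, called detection slots. In a given detection slot, the active interferers thus form a thinned version $\Phi_{\mathcal I}$ of $\Phi$ of intensity $\delta\lambda$. Antennas. Each device, including the typical node, has a boresight direction that is uniform on $[0,2\pi)$, independently of everything else. Cone antenna pattern: the antenna gain of a device is $\mathcal G_m$ in directions within its beam (the planar sector of angular width $\varphi$ centred on its boresight direction) and $0$ elsewhere. The paper sets $\mathcal G_m=4\pi/\varphi^2$. Received interference power (no-fading case). The power received at the typical node from an active interferer at $\mathbf x\in\Phi_{\mathcal I}$ is $P_t\,\mathcal G_t\,\mathcal G_r\,\ell\,\|\mathbf x\|^{-\alpha}$, where $P_t$ is the transmit power, $\ell=[c/(4\pi f)]^2$ is a positive constant ($c$ the speed of light, $f$ the carrier frequency), $\mathcal G_t$ is the gain of the antenna of the device at $\mathbf x$ in the direction of the origin, and $\mathcal G_r$ is the gain of the antenna of the typical node in the direction of $\mathbf x$. The power of the strongest interferer over a detection slot is $$\mathcal I_s=\sup_{\mathbf x\in\Phi_{\mathcal I}} P_t\,\mathcal G_t\,\mathcal G_r\,\ell\,\|\mathbf x\|^{-\alpha}.$$ Target echo and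 detection. A target of radar cross section $\sigma$ at distance $d$ in the boresight direction of the typical node returns, without fading, the echo power $\mathcal S$ given in the claim, where $\kappa$ is a signal processing gain. A target is declared present if the incoming power over any detection slot exceeds $\Theta$; noise is disregarded. A false alarm is the event that, in the absence of a target echo, the power in at least one of the $M-1$ detection slots exceeds $\Theta$; interference over the detection slots is i.i.d., so under the strongest-interferer model its probability is $1-F_{\mathcal I_s}(\Theta)^{M-1}$. *)

theory Defs
  imports "HOL-Probability.Probability"
begin

section \<open>Homogeneous Poisson point process on the plane\<close>

text \<open>
  A point process is an enumeration \<open>x 0, x 1, \<dots>\<close> of its points, counted with multiplicity;
  for a Poisson process with Lebesgue intensity the points are almost surely distinct.
  Local finiteness is required explicitly because \<^const>\<open>card\<close> is \<open>0\<close> on infinite sets.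
\<close>

definition num_points :: "(nat \<Rightarrow> 'w \<Rightarrow> real ^ 2) \<Rightarrow> (real ^ 2) set \<Rightarrow> 'w \<Rightarrow> nat" where
  "num_points x B \<omega> = card {i. x i \<omega> \<in> B}"

definition (in prob_space) poisson_point_process :: "real \<Rightarrow> (nat \<Rightarrow> 'a \<Rightarrow> real ^ 2) \<Rightarrow> bool" where
  "poisson_point_process lam x \<longleftrightarrow>
     (\<forall>i. random_variable borel (x i)) \<and>
     (AE \<omega> in M. \<forall>B. bounded B \<longrightarrow> finite {i. x i \<omega> \<in> B}) \<and>
     (\<forall>B k. B \<in> sets borel \<longrightarrow> bounded B \<longrightarrow>
        prob {\<omega> \<in> space M. num_points x B \<omega> = k}
          = (lam * measure lborel B) ^ k / fact k * exp (- (lam * measure lborel B))) \<and>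
     (\<forall>(n::nat) B. (\<forall>j<n. B j \<in> sets borel \<and> bounded (B j)) \<longrightarrow> disjoint_family_on B {..<n} \<longrightarrow>
        indep_vars (\<lambda>_. count_space UNIV) (\<lambda>j. num_points x (B j)) {..<n})"

section \<open>The radar network\<close>

text \<open>
  \<open>x i\<close>, \<open>m i\<close> and \<open>b i\<close> are the position, the slot mark and the boresight angle of device \<open>i\<close>,
  and \<open>b0\<close> is the boresight angle of the typical node at the origin.  The library's
  \<open>indep_vars\<close> needs random variables of a single type, so mutual independence of the point
  process, \<open>b0\<close>, and all \<open>m i\<close> and \<open>b i\<close> is stated for the generated sigma-algebras.
\<close>

datatype source = Points | Receiver_Boresight | Mark nat | Boresight nat

definition generated_events :: "'w measure \<Rightarrow> ('w \<Rightarrow> 'b) \<Rightarrow> 'b measure \<Rightarrow> 'w set set" where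
  "generated_events P X N = {X -` A \<inter> space P | A. A \<in> sets N}"

locale radar_network = prob_space P
  for P :: "'w measure"
    and lam :: real
    and M :: nat
    and x :: "nat \<Rightarrow> 'w \<Rightarrow> real ^ 2"
    and m :: "nat \<Rightarrow> 'w \<Rightarrow> nat"
    and b :: "nat \<Rightarrow> 'w \<Rightarrow> real"
    and b0 :: "'w \<Rightarrow> real" +
  assumes points: "poisson_point_process lam x"
    and mark_measurable: "\<And>i. random_variable (count_space UNIV) (m i)"
    and mark_uniform: "\<And>i. distr P (count_space UNIV) (m i) = measure_pmf (pmf_of_set {..<M})"
    and boresight_measurable: "\<And>i. random_variable borel (b i)"
    and boresight_uniform: "\<And>i. distr P borel (b i) = uniform_measure lborel {0..<2 * pi}"
    and boresight0_measurable: "random_variable borel b0"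
    and boresight0_uniform: "distr P borel b0 = uniform_measure lborel {0..<2 * pi}"
    and independent:
      "indep_sets
         (\<lambda>s. case s of
            Points \<Rightarrow> generated_events P (\<lambda>\<omega> i. x i \<omega>) (PiM UNIV (\<lambda>_. borel))
          | Receiver_Boresight \<Rightarrow> generated_events P b0 borel
          | Mark i \<Rightarrow> generated_events P (m i) (count_space UNIV)
          | Boresight i \<Rightarrow> generated_events P (b i) borel)
         UNIV"

definition transmits_in :: "nat \<Rightarrow> nat \<Rightarrow> nat \<Rightarrow> bool" where
  "transmits_in M mark slot \<longleftrightarrow> (\<exists>k. slot = mark + k * M)"

section \<open>Cone antenna pattern and received power\<close>

definition direction :: "real \<Rightarrow> real ^ 2" where
  "direction \<psi> = vector [cos \<psi>, sin \<psi>]"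

definition beam :: "real \<Rightarrow> real ^ 2 \<Rightarrow> real \<Rightarrow> (real ^ 2) set" where
  "beam \<phi> p \<theta> = {p + r *\<^sub>R direction \<psi> | r \<psi>. 0 \<le> r \<and> \<bar>\<psi> - \<theta>\<bar> \<le> \<phi> / 2}"

text \<open>Gain, in the direction of \<open>q\<close>, of an antenna located at \<open>p\<close> with boresight angle \<open>\<theta>\<close>.\<close>

definition cone_gain :: "real \<Rightarrow> real \<Rightarrow> real ^ 2 \<Rightarrow> real \<Rightarrow> real ^ 2 \<Rightarrow> real" where
  "cone_gain Gm \<phi> p \<theta> q = (if q \<in> beam \<phi> p \<theta> then Gm else 0)"

text \<open>
  Power received at the origin (boresight \<open>\<theta>0\<close>) from a device at \<open>y\<close> (boresight \<open>\<theta>\<close>).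
  The junk value \<open>0 powr (-\<alpha>) = 0\<close> at \<open>y = 0\<close> is only met with probability \<open>0\<close>.
\<close>

definition received_power ::
    "real \<Rightarrow> real \<Rightarrow> real \<Rightarrow> real \<Rightarrow> real \<Rightarrow> real \<Rightarrow> real ^ 2 \<Rightarrow> real \<Rightarrow> real" where
  "received_power Pt Gm l \<alpha> \<phi> \<theta>0 y \<theta> =
     Pt * cone_gain Gm \<phi> y \<theta> 0 * cone_gain Gm \<phi> 0 \<theta>0 y * l * norm y powr (- \<alpha>)"

text \<open>
  The supremum is taken in \<^typ>\<open>ennreal\<close>: it is \<open>0\<close> without active interferers and needs no
  boundedness condition.
\<close>

definition strongest_interference ::
    "real \<Rightarrow> real \<Rightarrow> real \<Rightarrow> real \<Rightarrow> real \<Rightarrow> nat \<Rightarrow> (nat \<Rightarrow> 'w \<Rightarrow> real ^ 2) \<Rightarrow>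
     (nat \<Rightarrow> 'w \<Rightarrow> nat) \<Rightarrow> (nat \<Rightarrow> 'w \<Rightarrow> real) \<Rightarrow> ('w \<Rightarrow> real) \<Rightarrow> nat \<Rightarrow> 'w \<Rightarrow> ennreal" where
  "strongest_interference Pt Gm l \<alpha> \<phi> M x m b b0 slot \<omega> =
     (SUP i \<in> {i. transmits_in M (m i \<omega>) slot}.
        ennreal (received_power Pt Gm l \<alpha> \<phi> (b0 \<omega>) (x i \<omega>) (b i \<omega>)))"

definition prob_at_most :: "'w measure \<Rightarrow> ('w \<Rightarrow> ennreal) \<Rightarrow> real \<Rightarrow> real" where
  "prob_at_most P X t = measure P {\<omega> \<in> space P. X \<omega> \<le> ennreal t}"

definition echo_power :: "real \<Rightarrow> real \<Rightarrow> real \<Rightarrow> real \<Rightarrow> real \<Rightarrow> real \<Rightarrow> real \<Rightarrow> real" where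
  "echo_power Pt Gm \<kappa> \<sigma> l \<alpha> d = Pt * Gm\<^sup>2 * \<kappa> * \<sigma> * l / (4 * pi) * d powr (- 2 * \<alpha>)"

definition is_critical_distance :: "(real \<Rightarrow> real) \<Rightarrow> real \<Rightarrow> real \<Rightarrow> bool" where
  "is_critical_distance S \<Theta> d \<longleftrightarrow> d > 0 \<and> S d = \<Theta>"

end

(*
  Conditionally on the point process and the receiver boresight, each point in the receiving
  sector of radius R = (Pt Gm^2 l / Theta)^(1/alpha) independently raises the power above Theta
  with probability q = phi / (2 pi M).  The process has Poisson(mu) points in that sector, with
  mu = lam phi R^2 / 2, so none of them does so with probability E[(1 - q)^N] = exp(- q mu)
  = exp(- lam phi^2 R^2 / (4 pi M)); raising it to the power M - 1 and solving
  for R gives the critical distance.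
*)

theory Submission
  imports Defs
begin

section \<open>Planar sectors\<close>

text \<open>The Poisson law speaks of counts in one fixed bounded set, whereas the event at hand
  mixes infinitely many points, marks and boresights with a sector that turns with the receiver
  boresight. The event is therefore written as a limit of products of 0/1 factors over the first n
  enumerated points. In each product the boresight and then the mark of one point at a time are
  averaged out, leaving the weight 1 - q for a point in the sector and 1 for any other. Fubini then
  holds the receiver boresight fixed, so the Poisson law is applied to one sector at a time; the
  area does not depend on the angle, so neither does the limit. The echo leads to the same radius:
  the critical distance is a power of kappa sigma / (4 pi) times sqrt R. Hence Pt, Gm, l and Theta
  enter only through R, and solving the false alarm equation for R^2 produces the exponent
  1/4.\<close>

lemma inner_real2: "v \<bullet> w = v $ 1 * w $ 1 + v $ 2 * w $ 2" for v w :: "real ^ 2"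
  by (simp add: inner_vec_def sum_2)

lemma norm_direction [simp]: "norm (direction \<psi>) = 1"
  by (simp add: norm_eq_sqrt_inner inner_real2 direction_def flip: power2_eq_square)

lemma inner_direction: "direction \<psi> \<bullet> direction \<theta> = cos (\<psi> - \<theta>)"
  by (simp add: inner_real2 direction_def cos_diff)

text \<open>A polar angle is free up to whole turns, so it can be taken within half a turn of any
  prescribed centre. The choice of the centre later decides on which branch cosines are
  compared.\<close>

lemma polar_form_near:
  fixes v :: "real ^ 2"
  obtains \<psi> where "v = norm v *\<^sub>R direction \<psi>" "\<bar>\<psi> - \<theta>\<bar> \<le> pi"
proof (cases "v = 0")
  case True
  then show ?thesis using that[of \<theta>] by simp
next
  case False
  have "(norm v)\<^sup>2 = (v $ 1)\<^sup>2 + (v $ 2)\<^sup>2"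
    unfolding power2_norm_eq_inner inner_real2 by (simp add: power2_eq_square)
  moreover have "(norm v)\<^sup>2 \<noteq> 0" using False by simp
  moreover have "(v $ 1 / norm v)\<^sup>2 + (v $ 2 / norm v)\<^sup>2 = ((v $ 1)\<^sup>2 + (v $ 2)\<^sup>2) / (norm v)\<^sup>2"
    by (simp add: power_divide add_divide_distrib)
  ultimately have "(v $ 1 / norm v)\<^sup>2 + (v $ 2 / norm v)\<^sup>2 = 1"
    by (metis divide_self)
  then obtain t where t: "v $ 1 / norm v = cos t" "v $ 2 / norm v = sin t"
    by (metis sincos_total_2pi)
  \<comment> \<open>The number of whole turns whose removal brings \<open>t - \<theta>\<close> into
    the half-open interval from \<open>- pi\<close> to \<open>pi\<close>.\<close>
  define n where "n = \<lfloor>(t - \<theta> + pi) / (2 * pi)\<rfloor>"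
  define \<psi> where "\<psi> = t - 2 * pi * of_int n"
  have *: "sin t = sin \<psi> \<and> cos t = cos \<psi>"
    unfolding sin_cos_eq_iff by (rule exI[of _ n]) (simp add: \<psi>_def)
  have "v $ 1 = norm v * cos t" "v $ 2 = norm v * sin t"
    unfolding t[symmetric] using False by simp_all
  then have "v = norm v *\<^sub>R direction \<psi>"
    unfolding vec_eq_iff forall_2 by (simp add: direction_def *)
  moreover have "of_int n \<le> (t - \<theta> + pi) / (2 * pi)" "(t - \<theta> + pi) / (2 * pi) < of_int n + 1"
    unfolding n_def by linarith+
  then have "\<bar>\<psi> - \<theta>\<bar> \<le> pi"
    unfolding \<psi>_def by (simp add: field_simps abs_le_iff)
  ultimately show ?thesis by (rule that)
qed

text \<open>
  Equivalence with a single closed inequality makes the beam jointly measurable in the point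
  and the boresight angle.
\<close>

lemma beam_iff_inner:
  assumes "0 < \<phi>" "\<phi> \<le> 2 * pi"
  shows "q \<in> beam \<phi> p \<theta> \<longleftrightarrow> norm (q - p) * cos (\<phi> / 2) \<le> (q - p) \<bullet> direction \<theta>"
proof
  assume "q \<in> beam \<phi> p \<theta>"
  then obtain r \<psi> where q: "q = p + r *\<^sub>R direction \<psi>" "0 \<le> r" "\<bar>\<psi> - \<theta>\<bar> \<le> \<phi> / 2"
    by (auto simp: beam_def)
  have "cos (\<phi> / 2) \<le> cos \<bar>\<psi> - \<theta>\<bar>"
    using q(3) assms by (intro cos_monotone_0_pi_le) auto
  then show "norm (q - p) * cos (\<phi> / 2) \<le> (q - p) \<bullet> direction \<theta>"
    using q by (simp add: inner_direction mult_left_mono)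
next
  assume *: "norm (q - p) * cos (\<phi> / 2) \<le> (q - p) \<bullet> direction \<theta>"
  obtain \<psi> where \<psi>: "q - p = norm (q - p) *\<^sub>R direction \<psi>" "\<bar>\<psi> - \<theta>\<bar> \<le> pi"
    by (rule polar_form_near)
  show "q \<in> beam \<phi> p \<theta>"
  proof (cases "q = p")
    case True
    then have "q = p + 0 *\<^sub>R direction \<theta>" "\<bar>\<theta> - \<theta>\<bar> \<le> \<phi> / 2" using assms by auto
    then show ?thesis unfolding beam_def by blast
  next
    case False
    have "(q - p) \<bullet> direction \<theta> = norm (q - p) * cos (\<psi> - \<theta>)"
      by (subst \<psi>(1)) (simp add: inner_direction)
    with * False have "cos (\<phi> / 2) \<le> cos \<bar>\<psi> - \<theta>\<bar>" by simp
    then have "\<bar>\<psi> - \<theta>\<bar> \<le> \<phi> / 2"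
      using \<psi>(2) assms by (subst (asm) cos_mono_le_eq) auto
    moreover have "q = p + norm (q - p) *\<^sub>R direction \<psi>" using \<psi>(1) by (simp add: algebra_simps)
    ultimately show ?thesis unfolding beam_def using norm_ge_zero by blast
  qed
qed

lemma direction_measurable [measurable]: "direction \<in> borel_measurable borel"
proof (rule borel_measurable_continuous_onI)
  have *: "direction = (\<lambda>\<psi>. \<chi> i. if i = 1 then cos \<psi> else sin \<psi>)"
    by (simp add: direction_def fun_eq_iff vec_eq_iff forall_2)
  have "continuous_on UNIV (\<lambda>\<psi>. if i = (1 :: 2) then cos \<psi> else sin \<psi> :: real)" for i
    by (cases "i = 1") (auto intro: continuous_intros)
  then show "continuous_on UNIV direction"
    unfolding * by (rule continuous_on_vec_lambda)
qed

text \<open>The inequality holds exactly on the arcs of half-width \<open>c\<close> around the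
  multiples of \<open>2 * pi\<close>. The window for \<open>u\<close> begins just after the arc
  around \<open>- 2 * pi\<close> and ends with the arc around \<open>2 * pi\<close>, so only the
  arcs around 0 and \<open>2 * pi\<close> matter.\<close>

lemma cos_le_cos_iff:
  assumes "0 \<le> c" "c \<le> pi" "- (2 * pi - c) < u" "u \<le> 2 * pi + c"
  shows "cos c \<le> cos u \<longleftrightarrow> \<bar>u\<bar> \<le> c \<or> 2 * pi - c \<le> u"
proof -
  consider "\<bar>u\<bar> \<le> pi" | "pi < u" "u \<le> 2 * pi" | "u < - pi" | "2 * pi < u"
    by linarith
  then show ?thesis
  proof cases
    case 1
    then show ?thesis using assms cos_mono_le_eq[of c "\<bar>u\<bar>"] by auto
  next
    case 2
    have "cos u = cos (2 * pi - u)" by simp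
    then show ?thesis using 2 assms cos_mono_le_eq[of c "2 * pi - u"] by auto
  next
    case 3
    have "cos u = cos (2 * pi + u)" by (simp add: cos_add)
    then show ?thesis using 3 assms cos_mono_le_eq[of c "2 * pi + u"] by auto
  next
    case 4
    have "cos u = cos (u - 2 * pi)" by (simp add: cos_diff)
    then show ?thesis using 4 assms cos_mono_le_eq[of c "u - 2 * pi"] by auto
  qed
qed

text \<open>The beam condition in terms of the displacement \<open>v\<close> from the antenna. The
  same test serves the receiver, with \<open>v\<close> the position of the interferer, and the
  interferer, with \<open>v\<close> its negative.\<close>

abbreviation in_cone :: "real \<Rightarrow> real \<Rightarrow> real ^ 2 \<Rightarrow> bool" where
  "in_cone \<phi> \<theta> v \<equiv> norm v * cos (\<phi> / 2) \<le> v \<bullet> direction \<theta>"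

text \<open>The boresights whose beam covers \<open>v\<close> form an arc of length
  \<open>\<phi>\<close> centred at the polar angle of \<open>v\<close>. The work lies in cutting
  this arc at the ends of the interval of angles.\<close>

lemma emeasure_boresights:
  fixes v :: "real ^ 2"
  assumes "0 < \<phi>" "\<phi> \<le> 2 * pi" "v \<noteq> 0"
  shows "emeasure lborel ({0..<2 * pi} \<inter> {\<theta>. in_cone \<phi> \<theta> v}) = ennreal \<phi>"
proof -
  \<comment> \<open>This centre puts the left end \<open>a\<close> of the arc between 0 and
    \<open>2 * pi\<close>, so the arc can wrap around only on the right.\<close>
  obtain \<psi> where \<psi>: "v = norm v *\<^sub>R direction \<psi>" "\<bar>\<psi> - (\<phi> / 2 + pi)\<bar> \<le> pi"
    by (rule polar_form_near)
  define a where "a = \<psi> - \<phi> / 2"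
  have a: "0 \<le> a" "a \<le> 2 * pi" using \<psi>(2) by (auto simp: a_def abs_le_iff)
  have "norm v * cos (\<phi> / 2) \<le> v \<bullet> direction \<theta> \<longleftrightarrow> cos (\<phi> / 2) \<le> cos (\<psi> - \<theta>)" for \<theta>
    using assms(3) by (subst (2) \<psi>(1)) (simp add: inner_direction)
  moreover have "cos (\<phi> / 2) \<le> cos (\<psi> - \<theta>) \<longleftrightarrow> a \<le> \<theta> \<and> \<theta> \<le> a + \<phi> \<or> \<theta> \<le> a + \<phi> - 2 * pi"
    if "0 \<le> \<theta>" "\<theta> < 2 * pi" for \<theta>
  proof -
    have "\<bar>\<psi> - \<theta>\<bar> \<le> \<phi> / 2 \<longleftrightarrow> a \<le> \<theta> \<and> \<theta> \<le> a + \<phi>"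
      "2 * pi - \<phi> / 2 \<le> \<psi> - \<theta> \<longleftrightarrow> \<theta> \<le> a + \<phi> - 2 * pi"
      unfolding a_def by arith+
    moreover have "cos (\<phi> / 2) \<le> cos (\<psi> - \<theta>) \<longleftrightarrow> \<bar>\<psi> - \<theta>\<bar> \<le> \<phi> / 2 \<or> 2 * pi - \<phi> / 2 \<le> \<psi> - \<theta>"
      using that assms a unfolding a_def by (intro cos_le_cos_iff) linarith+
    ultimately show ?thesis by simp
  qed
  ultimately have S: "{0..<2 * pi} \<inter> {\<theta>. in_cone \<phi> \<theta> v} =
      {0..<2 * pi} \<inter> {\<theta>. a \<le> \<theta> \<and> \<theta> \<le> a + \<phi> \<or> \<theta> \<le> a + \<phi> - 2 * pi}"
    by auto
  \<comment> \<open>No wrap, a wrap into two disjoint pieces, and the full circle. The last is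
    separate because there the two pieces would both reach \<open>a\<close>.\<close>
  consider "a + \<phi> < 2 * pi" | "2 * pi \<le> a + \<phi>" "\<phi> < 2 * pi" | "\<phi> = 2 * pi"
    using assms(2) by linarith
  then show ?thesis
  proof cases
    case 1
    then have "{0..<2 * pi} \<inter> {\<theta>. a \<le> \<theta> \<and> \<theta> \<le> a + \<phi> \<or> \<theta> \<le> a + \<phi> - 2 * pi} = {a..a + \<phi>}"
      using a by auto
    then show ?thesis using S assms(1) by simp
  next
    case 2
    then have "{0..<2 * pi} \<inter> {\<theta>. a \<le> \<theta> \<and> \<theta> \<le> a + \<phi> \<or> \<theta> \<le> a + \<phi> - 2 * pi} =
        {a..<2 * pi} \<union> {0..a + \<phi> - 2 * pi}"
      using a by auto
    moreover have "emeasure lborel ({a..<2 * pi} \<union> {0..a + \<phi> - 2 * pi}) =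
        emeasure lborel {a..<2 * pi} + emeasure lborel {0..a + \<phi> - 2 * pi}"
      using 2 by (intro plus_emeasure[symmetric]) auto
    ultimately show ?thesis using S a 2 by (simp flip: ennreal_plus)
  next
    case 3
    then have "{0..<2 * pi} \<inter> {\<theta>. a \<le> \<theta> \<and> \<theta> \<le> a + \<phi> \<or> \<theta> \<le> a + \<phi> - 2 * pi} = {0..<2 * pi}"
      using a by auto
    then show ?thesis using S 3 by simp
  qed
qed

section \<open>Rotations of the plane and the area of a sector\<close>

definition rotate2 :: "real \<Rightarrow> real ^ 2 \<Rightarrow> real ^ 2" where
  "rotate2 t v = vector [cos t * v $ 1 - sin t * v $ 2, sin t * v $ 1 + cos t * v $ 2]"

lemma inner_rotate2: "rotate2 t v \<bullet> rotate2 t w = v \<bullet> w"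
proof -
  have "rotate2 t v \<bullet> rotate2 t w = ((cos t)\<^sup>2 + (sin t)\<^sup>2) * (v \<bullet> w)"
    unfolding inner_real2 rotate2_def vector_2 by algebra
  then show ?thesis by simp
qed

lemma norm_rotate2: "norm (rotate2 t v) = norm v"
  by (simp add: norm_eq_sqrt_inner inner_rotate2)

lemma rotate2_eq_0_iff: "rotate2 t v = 0 \<longleftrightarrow> v = 0"
  by (metis norm_eq_zero norm_rotate2)

lemma orthogonal_transformation_rotate2: "orthogonal_transformation (rotate2 t)"
  unfolding orthogonal_transformation_def
  by (auto simp: inner_rotate2 linear_iff)
    (auto simp: rotate2_def vec_eq_iff forall_2 algebra_simps)

lemma rotate2_direction: "rotate2 t (direction \<theta>) = direction (\<theta> + t)"
  by (simp add: rotate2_def direction_def vec_eq_iff forall_2 cos_add sin_add)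

lemma rotate2_rotate2_minus: "rotate2 t (rotate2 (- t) v) = v"
proof -
  have *: "cos t * (cos t * c) + sin t * (sin t * c) = c" for c
  proof -
    have *: "cos t * (cos t * c) + sin t * (sin t * c) = ((cos t)\<^sup>2 + (sin t)\<^sup>2) * c"
      by algebra
    then show ?thesis by simp
  qed
  show ?thesis
    using *[of "v $ 1"] *[of "v $ 2"]
    unfolding rotate2_def vec_eq_iff forall_2 vector_2 cos_minus sin_minus
    by (auto simp only: algebra_simps mult_minus_left mult_minus_right)
qed

text \<open>The radius bound is strict because the power must exceed the threshold strictly. The
  origin is left out: every beam of the receiver contains it, and the received power there is 0 by
  convention.\<close>

definition sector :: "real \<Rightarrow> real \<Rightarrow> real \<Rightarrow> (real ^ 2) set" where
  "sector \<phi> R \<theta> = {v. v \<noteq> 0 \<and> norm v < R \<and> in_cone \<phi> \<theta> v}"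

lemma sector_borel [measurable]: "sector \<phi> R \<theta> \<in> sets borel"
  unfolding sector_def by measurable

lemma in_sector_measurable [measurable (raw)]:
  assumes [measurable]: "X \<in> borel_measurable N" "T \<in> borel_measurable N"
  shows "Measurable.pred N (\<lambda>\<omega>. X \<omega> \<in> sector \<phi> R (T \<omega>))"
  unfolding sector_def by measurable

lemma bounded_sector: "bounded (sector \<phi> R \<theta>)"
  by (rule bounded_subset[OF bounded_ball[of 0 R]]) (auto simp: sector_def)

lemma measure_sector_rotate:
  "measure lborel (sector \<phi> R (\<theta> + t)) = measure lborel (sector \<phi> R \<theta>)"
proof -
  have "sector \<phi> R (\<theta> + t) = rotate2 t ` sector \<phi> R \<theta>"
  proof (intro equalityI subsetI)
    fix v assume v: "v \<in> sector \<phi> R (\<theta> + t)"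
    have "v = rotate2 t (rotate2 (- t) v)" by (simp add: rotate2_rotate2_minus)
    moreover have "rotate2 (- t) v \<in> sector \<phi> R \<theta>"
    proof -
      have "rotate2 (- t) v \<bullet> direction \<theta> = rotate2 (- t) v \<bullet> rotate2 (- t) (direction (\<theta> + t))"
        by (simp add: rotate2_direction)
      then show ?thesis
        using v by (simp add: sector_def inner_rotate2 norm_rotate2 rotate2_eq_0_iff)
    qed
    ultimately show "v \<in> rotate2 t ` sector \<phi> R \<theta>" by (rule image_eqI)
  next
    fix v assume "v \<in> rotate2 t ` sector \<phi> R \<theta>"
    then obtain w where w: "v = rotate2 t w" "w \<in> sector \<phi> R \<theta>" by auto
    have "rotate2 t w \<bullet> direction (\<theta> + t) = w \<bullet> direction \<theta>"
      by (simp add: inner_rotate2 flip: rotate2_direction)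
    then show "v \<in> sector \<phi> R (\<theta> + t)"
      using w by (simp add: sector_def norm_rotate2 rotate2_eq_0_iff)
  qed
  moreover have "sector \<phi> R \<theta> \<in> lmeasurable"
    by (intro bounded_set_imp_lmeasurable bounded_sector) simp
  \<comment> \<open>Invariance under orthogonal maps is applied in the completion, which agrees with
    \<open>lborel\<close> on Borel sets.\<close>
  ultimately have "measure lebesgue (sector \<phi> R (\<theta> + t)) = measure lebesgue (sector \<phi> R \<theta>)"
    using measure_orthogonal_image[OF orthogonal_transformation_rotate2] by metis
  then show ?thesis by (simp add: measure_completion)
qed

text \<open>
  Rotation invariance reduces the area to its average over all boresight angles, which Fubini
  turns into the area of the disc times the constant beam width.
\<close>

lemma measure_sector:
  assumes "0 < \<phi>" "\<phi> \<le> 2 * pi" "0 < R"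
  shows "measure lborel (sector \<phi> R \<theta>) = \<phi> * R\<^sup>2 / 2"
proof -
  define A where "A = measure lborel (sector \<phi> R 0)"
  have "measure lborel (sector \<phi> R t) = A" for t
    using measure_sector_rotate[of \<phi> R 0 t] by (simp add: A_def)
  moreover have "emeasure lborel (sector \<phi> R t) \<noteq> \<infinity>" for t
    using emeasure_bounded_finite[OF bounded_sector] by (metis less_irrefl infinity_ennreal_def)
  ultimately have A: "emeasure lborel (sector \<phi> R t) = ennreal A" for t
    by (simp add: emeasure_eq_ennreal_measure)
  have A0: "0 \<le> A" by (simp add: A_def)
  have "ennreal A * ennreal (2 * pi) = (\<integral>\<^sup>+t. ennreal A * indicator {0..<2 * pi} t \<partial>lborel)"
    by (subst nn_integral_cmult_indicator) auto
  also have "\<dots> = (\<integral>\<^sup>+t. \<integral>\<^sup>+v. indicator (sector \<phi> R t) v * indicator {0..<2 * pi} t \<partial>lborel \<partial>lborel)"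
    by (intro nn_integral_cong) (simp add: nn_integral_multc A)
  also have "\<dots> = (\<integral>\<^sup>+v. \<integral>\<^sup>+t. indicator (sector \<phi> R t) v * indicator {0..<2 * pi} t \<partial>lborel \<partial>lborel)"
    by (rule lborel_pair.Fubini') (simp add: indicator_def[abs_def] split_def)
  \<comment> \<open>For fixed \<open>v\<close> the inner integral measures the boresights covering
    \<open>v\<close>, which is \<open>\<phi>\<close> for every nonzero \<open>v\<close> in the
    disc.\<close>
  also have "\<dots> = (\<integral>\<^sup>+v. ennreal \<phi> * indicator (ball 0 R - {0 :: real ^ 2}) v \<partial>lborel)"
  proof (intro nn_integral_cong)
    fix v :: "real ^ 2"
    have "(\<integral>\<^sup>+t. indicator (sector \<phi> R t) v * indicator {0..<2 * pi} t \<partial>lborel) =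
      (\<integral>\<^sup>+t. indicator (ball 0 R - {0}) v *
         indicator ({0..<2 * pi} \<inter> {\<theta>. in_cone \<phi> \<theta> v}) t \<partial>lborel)"
      by (intro nn_integral_cong) (auto simp: sector_def indicator_def)
    also have "\<dots> = indicator (ball 0 R - {0}) v *
        emeasure lborel ({0..<2 * pi} \<inter> {\<theta>. in_cone \<phi> \<theta> v})"
      by (subst nn_integral_cmult_indicator) auto
    also have "\<dots> = ennreal \<phi> * indicator (ball 0 R - {0}) v"
    proof (cases "v = 0")
      case False
      then show ?thesis by (subst emeasure_boresights[OF assms(1,2) False]) (rule mult.commute)
    qed simp
    finally show "(\<integral>\<^sup>+t. indicator (sector \<phi> R t) v * indicator {0..<2 * pi} t \<partial>lborel) =
        ennreal \<phi> * indicator (ball 0 R - {0}) v" .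
  qed
  also have "\<dots> = ennreal \<phi> * emeasure lborel (ball 0 R - {0 :: real ^ 2})"
    by (subst nn_integral_cmult_indicator) auto
  also have "emeasure lborel (ball 0 R - {0 :: real ^ 2}) = emeasure lborel (ball 0 R :: (real ^ 2) set)"
    by (rule emeasure_Diff_null_set) auto
  also have "\<dots> = ennreal (pi * R\<^sup>2)"
    using assms by (simp add: emeasure_ball unit_ball_vol_2)
  finally have "ennreal (A * (2 * pi)) = ennreal (\<phi> * (pi * R\<^sup>2))"
    using assms A0 by (simp add: ennreal_mult)
  then have "A * (2 * pi) = \<phi> * (pi * R\<^sup>2)"
    using assms A0 by (subst (asm) ennreal_inj) auto
  then have "A = \<phi> * R\<^sup>2 / 2" by (simp add: field_simps)
  then show ?thesis by (simp add: \<open>measure lborel (sector \<phi> R \<theta>) = A\<close>)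
qed

section \<open>Independence and Poisson generating functions\<close>

text \<open>Independence makes the joint law a product, and Tonelli splits the integral. The target
  \<open>F\<close> is arbitrary so that \<open>U\<close> may be the identity into a
  sub-sigma-algebra; \<open>H\<close> can then depend on everything measurable there.\<close>

lemma (in prob_space) nn_integral_indep_pair:
  assumes [measurable]: "U \<in> measurable M F" "V \<in> measurable M N"
    and indep: "indep_set (generated_events M U F) (generated_events M V N)"
    and [measurable]: "H \<in> borel_measurable (F \<Otimes>\<^sub>M N)"
  shows "(\<integral>\<^sup>+\<omega>. H (U \<omega>, V \<omega>) \<partial>M) = (\<integral>\<^sup>+\<omega>. \<integral>\<^sup>+v. H (U \<omega>, v) \<partial>distr M N V \<partial>M)"
proof -
  interpret U: prob_space "distr M F U" by (rule prob_space_distr) simp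
  interpret V: prob_space "distr M N V" by (rule prob_space_distr) simp
  have "distr M F U \<Otimes>\<^sub>M distr M N V = distr M (F \<Otimes>\<^sub>M N) (\<lambda>\<omega>. (U \<omega>, V \<omega>))"
  proof (rule pair_measure_eqI)
    fix A B assume "A \<in> sets (distr M F U)" "B \<in> sets (distr M N V)"
    then have [measurable]: "A \<in> sets F" "B \<in> sets N" by auto
    have "prob ((U -` A \<inter> space M) \<inter> (V -` B \<inter> space M)) =
        prob (U -` A \<inter> space M) * prob (V -` B \<inter> space M)"
      by (rule indep_setD[OF indep])
        (auto simp: generated_events_def intro: \<open>A \<in> sets F\<close> \<open>B \<in> sets N\<close>)
    moreover have "(\<lambda>\<omega>. (U \<omega>, V \<omega>)) -` (A \<times> B) \<inter> space M = (U -` A \<inter> space M) \<inter> (V -` B \<inter> space M)"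
      by auto
    ultimately show "emeasure (distr M F U) A * emeasure (distr M N V) B =
        emeasure (distr M (F \<Otimes>\<^sub>M N) (\<lambda>\<omega>. (U \<omega>, V \<omega>))) (A \<times> B)"
      by (simp add: emeasure_distr emeasure_eq_measure ennreal_mult)
  qed (simp_all cong: sets_pair_measure_cong add: U.sigma_finite_measure_axioms V.sigma_finite_measure_axioms)
  then have "(\<integral>\<^sup>+\<omega>. H (U \<omega>, V \<omega>) \<partial>M) = (\<integral>\<^sup>+z. H z \<partial>(distr M F U \<Otimes>\<^sub>M distr M N V))"
    by (simp add: nn_integral_distr)
  also have "\<dots> = (\<integral>\<^sup>+u. \<integral>\<^sup>+v. H (u, v) \<partial>distr M N V \<partial>distr M F U)"
    by (rule V.nn_integral_fst[symmetric]) simp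
  also have "\<dots> = (\<integral>\<^sup>+\<omega>. \<integral>\<^sup>+v. H (U \<omega>, v) \<partial>distr M N V \<partial>M)"
    by (rule nn_integral_distr) simp_all
  finally show ?thesis .
qed

lemma (in prob_space) nn_integral_if_one:
  assumes [measurable]: "Measurable.pred M p" and "r \<le> 1"
  shows "(\<integral>\<^sup>+\<omega>. (if p \<omega> then ennreal (1 - r) else 1) \<partial>M) = ennreal (1 - r * prob {\<omega> \<in> space M. p \<omega>})"
proof -
  have int: "integrable M (indicat_real {\<omega> \<in> space M. p \<omega>})"
    by (intro integrable_real_indicator) (measurable, simp add: emeasure_eq_measure)
  have "(\<integral>\<^sup>+\<omega>. (if p \<omega> then ennreal (1 - r) else 1) \<partial>M) =
      (\<integral>\<^sup>+\<omega>. ennreal (1 - r * indicator {\<omega> \<in> space M. p \<omega>} \<omega>) \<partial>M)"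
    by (intro nn_integral_cong) (auto simp: indicator_def)
  also have "\<dots> = ennreal (\<integral>\<omega>. 1 - r * indicator {\<omega> \<in> space M. p \<omega>} \<omega> \<partial>M)"
  proof (rule nn_integral_eq_integral)
    show "integrable M (\<lambda>\<omega>. 1 - r * indicator {\<omega> \<in> space M. p \<omega>} \<omega>)"
      using int by simp
  qed (use assms(2) in \<open>simp add: indicator_def\<close>)
  also have "(\<integral>\<omega>. 1 - r * indicator {\<omega> \<in> space M. p \<omega>} \<omega> \<partial>M) = 1 - r * prob {\<omega> \<in> space M. p \<omega>}"
    using int by (simp add: prob_space)
  finally show ?thesis .
qed

text \<open>The shape reproduces itself: averaging turns the defect \<open>r\<close> into
  \<open>r\<close> times a probability. Starting from \<open>r = 1\<close>, the boresight gives
  \<open>\<phi> / (2 * pi)\<close>, and the mark then divides this by \<open>M\<close>.\<close>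

lemma (in prob_space) nn_integral_mult_if_one:
  assumes [measurable]: "Measurable.pred M p" and "r \<le> 1"
  shows "(\<integral>\<^sup>+\<omega>. c * (if d \<and> p \<omega> then ennreal (1 - r) else 1) \<partial>M) =
    c * (if d then ennreal (1 - r * prob {\<omega> \<in> space M. p \<omega>}) else 1)"
proof (cases d)
  case True
  have "(\<integral>\<^sup>+\<omega>. c * (if p \<omega> then ennreal (1 - r) else 1) \<partial>M) =
      c * (\<integral>\<^sup>+\<omega>. (if p \<omega> then ennreal (1 - r) else 1) \<partial>M)"
    by (rule nn_integral_cmult) measurable
  then show ?thesis
    using True by (simp only: nn_integral_if_one[OF assms] simp_thms if_True)
qed (simp add: emeasure_space_1)

text \<open>Measurability is part of \<open>indep_vars\<close>, so a family consisting of the single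
  set \<open>B\<close> yields it.\<close>

lemma (in prob_space) num_points_measurable:
  assumes ppp: "poisson_point_process lam x" and B: "B \<in> sets borel" "bounded B"
  shows "random_variable (count_space UNIV) (num_points x B)"
proof -
  have "\<forall>(n::nat) B. (\<forall>j<n. B j \<in> sets borel \<and> bounded (B j)) \<longrightarrow> disjoint_family_on B {..<n} \<longrightarrow>
        indep_vars (\<lambda>_. count_space UNIV) (\<lambda>j. num_points x (B j)) {..<n}"
    using ppp unfolding poisson_point_process_def by (elim conjE) assumption
  from this[rule_format, of 1 "\<lambda>_. B"] B
  have "indep_vars (\<lambda>_. count_space UNIV) (\<lambda>j. num_points x B) {..<1 :: nat}"
    by (simp add: disjoint_family_on_def)
  then show ?thesis by (simp add: indep_vars_def)
qed

text \<open>Splitting by the value of the count turns the expectation into the exponential series at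
  \<open>c\<close> times the mean.\<close>

lemma (in prob_space) poisson_generating_function:
  assumes ppp: "poisson_point_process lam x" and "0 \<le> lam" "0 \<le> c"
    and B: "B \<in> sets borel" "bounded B"
  shows "(\<integral>\<^sup>+\<omega>. ennreal c ^ num_points x B \<omega> \<partial>M) = ennreal (exp (- ((1 - c) * lam * measure lborel B)))"
proof -
  let ?\<mu> = "lam * measure lborel B"
  note [measurable] = num_points_measurable[OF ppp B]
  have prob: "prob {\<omega> \<in> space M. num_points x B \<omega> = k} = ?\<mu> ^ k / fact k * exp (- ?\<mu>)" for k
    using ppp B unfolding poisson_point_process_def by blast
  have "(\<integral>\<^sup>+\<omega>. ennreal c ^ num_points x B \<omega> \<partial>M) =
      (\<integral>\<^sup>+\<omega>. (\<Sum>k. ennreal (c ^ k) * indicator {\<omega> \<in> space M. num_points x B \<omega> = k} \<omega>) \<partial>M)"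
  proof (intro nn_integral_cong)
    fix \<omega> assume "\<omega> \<in> space M"
    then have "(\<lambda>k. ennreal (c ^ k) * indicator {\<omega> \<in> space M. num_points x B \<omega> = k} \<omega>) =
        (\<lambda>k. if k = num_points x B \<omega> then ennreal (c ^ k) else 0)"
      by (auto simp: indicator_def)
    then show "ennreal c ^ num_points x B \<omega> =
        (\<Sum>k. ennreal (c ^ k) * indicator {\<omega> \<in> space M. num_points x B \<omega> = k} \<omega>)"
      using sums_single[of "num_points x B \<omega>" "\<lambda>k. ennreal (c ^ k)"] \<open>0 \<le> c\<close>
      by (simp add: sums_iff ennreal_power)
  qed
  also have "\<dots> = (\<Sum>k. ennreal (c ^ k) * emeasure M {\<omega> \<in> space M. num_points x B \<omega> = k})"
    by (subst nn_integral_suminf) (auto simp: nn_integral_cmult_indicator)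
  also have "\<dots> = (\<Sum>k. ennreal (c ^ k * (?\<mu> ^ k / fact k * exp (- ?\<mu>))))"
    by (simp only: emeasure_eq_measure prob ennreal_mult'[OF zero_le_power[OF \<open>0 \<le> c\<close>]])
  also have "\<dots> = ennreal (exp (c * ?\<mu>) * exp (- ?\<mu>))"
  proof (rule suminf_ennreal_eq)
    have "(\<lambda>k. (c * ?\<mu>) ^ k /\<^sub>R fact k * exp (- ?\<mu>)) sums (exp (c * ?\<mu>) * exp (- ?\<mu>))"
      by (intro sums_mult2 exp_converges)
    then show "(\<lambda>k. c ^ k * (?\<mu> ^ k / fact k * exp (- ?\<mu>))) sums (exp (c * ?\<mu>) * exp (- ?\<mu>))"
      by (simp add: power_mult_distrib field_simps)
  qed (use assms in auto)
  also have "exp (c * ?\<mu>) * exp (- ?\<mu>) = exp (- ((1 - c) * lam * measure lborel B))"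
    by (simp add: algebra_simps flip: exp_add)
  finally show ?thesis .
qed

text \<open>Almost surely only finitely many indices fall in the bounded set, so the partial
  products become constant, equal to \<open>c\<close> to the power of the count. Since
  \<open>c \<le> 1\<close>, they are dominated by 1.\<close>

lemma (in prob_space) poisson_product_limit:
  assumes ppp: "poisson_point_process lam x" and "0 \<le> lam" "0 \<le> c" "c \<le> 1"
    and B: "B \<in> sets borel" "bounded B"
  shows "(\<lambda>n. \<integral>\<^sup>+\<omega>. (\<Prod>i<n. if x i \<omega> \<in> B then ennreal c else 1) \<partial>M)
    \<longlonglongrightarrow> ennreal (exp (- ((1 - c) * lam * measure lborel B)))"
proof -
  have [measurable]: "x i \<in> borel_measurable M" for i
    using ppp by (auto simp: poisson_point_process_def)
  note [measurable] = B(1)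
  note [measurable] = num_points_measurable[OF ppp B]
  have "(\<lambda>n. \<integral>\<^sup>+\<omega>. (\<Prod>i<n. if x i \<omega> \<in> B then ennreal c else 1) \<partial>M)
      \<longlonglongrightarrow> (\<integral>\<^sup>+\<omega>. ennreal c ^ num_points x B \<omega> \<partial>M)"
  proof (rule nn_integral_dominated_convergence[where w = "\<lambda>_. 1"])
    show "AE \<omega> in M. (\<Prod>i<n. if x i \<omega> \<in> B then ennreal c else 1) \<le> 1" for n
      using assms(3,4) by (intro AE_I2 prod_le_1) auto
    have "AE \<omega> in M. finite {i. x i \<omega> \<in> B}"
      using ppp B unfolding poisson_point_process_def by auto
    then show "AE \<omega> in M. (\<lambda>n. \<Prod>i<n. if x i \<omega> \<in> B then ennreal c else 1)
        \<longlonglongrightarrow> ennreal c ^ num_points x B \<omega>"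
    proof eventually_elim
      case (elim \<omega>)
      then obtain k where k: "\<forall>i\<in>{i. x i \<omega> \<in> B}. i < k"
        using finite_nat_set_iff_bounded by blast
      have "(\<Prod>i<n. if x i \<omega> \<in> B then ennreal c else 1) = ennreal c ^ num_points x B \<omega>" if "k \<le> n" for n
      proof -
        have "{..<n} \<inter> {i. x i \<omega> \<in> B} = {i. x i \<omega> \<in> B}"
          using k that by force
        then show ?thesis by (simp add: prod.If_cases num_points_def)
      qed
      then show ?case
        by (intro tendsto_eventually) (auto simp: eventually_sequentially)
    qed
  qed (simp_all add: emeasure_space_1)
  then show ?thesis
    using poisson_generating_function[OF assms(1-3) B] by simp
qed

section \<open>Sigma-algebras of the independent sources\<close>

lemma Int_stable_generated_events: "Int_stable (generated_events M V N)"
proof (rule Int_stableI)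
  fix A B assume "A \<in> generated_events M V N" "B \<in> generated_events M V N"
  then obtain A' B' where "A = V -` A' \<inter> space M" "B = V -` B' \<inter> space M" "A' \<in> sets N" "B' \<in> sets N"
    by (auto simp: generated_events_def)
  then have "A \<inter> B = V -` (A' \<inter> B') \<inter> space M" "A' \<inter> B' \<in> sets N" by auto
  then show "A \<inter> B \<in> generated_events M V N" unfolding generated_events_def by blast
qed

context radar_network
begin

definition source_events :: "source \<Rightarrow> 'w set set" where
  "source_events s = (case s of
      Points \<Rightarrow> generated_events P (\<lambda>\<omega> i. x i \<omega>) (PiM UNIV (\<lambda>_. borel))
    | Receiver_Boresight \<Rightarrow> generated_events P b0 borel
    | Mark i \<Rightarrow> generated_events P (m i) (count_space UNIV)
    | Boresight i \<Rightarrow> generated_events P (b i) borel)"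

text \<open>Being measurable with respect to \<open>info I\<close> expresses being determined by the
  sources in \<open>I\<close>. Only the sigma-algebra matters here; integrals are always taken over
  \<open>P\<close>.\<close>

definition info :: "source set \<Rightarrow> 'w measure" where
  "info I = sigma (space P) (\<Union>s\<in>I. source_events s)"

lemma indep_source_events: "indep_sets source_events UNIV"
  using independent unfolding source_events_def[abs_def] .

lemma source_events_subset: "source_events s \<subseteq> events"
  using indep_source_events by (auto simp: indep_sets_def)

lemma Union_source_events: "(\<Union>s\<in>I. source_events s) \<subseteq> Pow (space P)"
  using source_events_subset sets.sets_into_space by blast

lemma space_info [simp]: "space (info I) = space P"
  by (simp add: info_def space_measure_of_conv)

lemma sets_info: "sets (info I) = sigma_sets (space P) (\<Union>s\<in>I. source_events s)"
  unfolding info_def by (rule sets_measure_of[OF Union_source_events])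

lemma sets_info_subset: "sets (info I) \<subseteq> events"
  unfolding sets_info by (intro sets.sigma_sets_subset) (use source_events_subset in blast)

lemma measurable_info_imp: "f \<in> measurable (info I) N \<Longrightarrow> f \<in> measurable P N"
  using sets_info_subset unfolding measurable_def space_info by blast

lemma measurable_info:
  assumes "V \<in> measurable P N" "generated_events P V N \<subseteq> source_events s" "s \<in> I"
  shows "V \<in> measurable (info I) N"
proof (rule measurableI)
  fix A assume "A \<in> sets N"
  then have "V -` A \<inter> space P \<in> source_events s"
    using assms(2) by (auto simp: generated_events_def)
  then show "V -` A \<inter> space (info I) \<in> sets (info I)"
    using assms(3) by (auto simp: sets_info)
qed (use assms(1) in \<open>auto dest: measurable_space\<close>)

lemma measurable_info_mono:
  assumes "f \<in> measurable (info I) N" "I \<subseteq> J"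
  shows "f \<in> measurable (info J) N"
proof -
  have "sets (info I) \<subseteq> sets (info J)"
    unfolding sets_info using assms(2) by (intro sigma_sets_mono') blast
  then show ?thesis using assms(1) unfolding measurable_def space_info by blast
qed

lemma points_measurable: "x i \<in> borel_measurable P"
  using points unfolding poisson_point_process_def by blast

text \<open>All positions form a single source, since they are not independent of each other; each
  one is a coordinate of the whole sequence.\<close>

lemma points_measurable_info:
  assumes "Points \<in> I"
  shows "x i \<in> borel_measurable (info I)"
proof -
  have "(\<lambda>\<omega> i. x i \<omega>) \<in> measurable P (PiM UNIV (\<lambda>_. borel))"
    by (rule measurable_PiM_single') (auto simp: points_measurable)
  then have "(\<lambda>\<omega> i. x i \<omega>) \<in> measurable (info I) (PiM UNIV (\<lambda>_. borel))"
    by (rule measurable_info) (use assms in \<open>auto simp: source_events_def\<close>)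
  from measurable_compose[OF this measurable_component_singleton[OF UNIV_I]]
  show ?thesis .
qed

lemma boresight0_measurable_info: "Receiver_Boresight \<in> I \<Longrightarrow> b0 \<in> borel_measurable (info I)"
  by (rule measurable_info[OF boresight0_measurable]) (auto simp: source_events_def)

lemma mark_measurable_info: "Mark i \<in> I \<Longrightarrow> m i \<in> measurable (info I) (count_space UNIV)"
  by (rule measurable_info[OF mark_measurable]) (auto simp: source_events_def)

lemma boresight_measurable_info: "Boresight i \<in> I \<Longrightarrow> b i \<in> borel_measurable (info I)"
  by (rule measurable_info[OF boresight_measurable]) (auto simp: source_events_def)

lemma Int_stable_source_events: "Int_stable (source_events s)"
  by (cases s) (simp_all add: source_events_def Int_stable_generated_events)

text \<open>
  A variable drawn from a source outside \<open>I\<close> may be integrated out first, with everything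
  determined by the sources in \<open>I\<close> held fixed.
\<close>

lemma nn_integral_source:
  assumes V: "V \<in> measurable P N" "generated_events P V N \<subseteq> source_events s" "s \<notin> I"
    and H: "H \<in> borel_measurable (info I \<Otimes>\<^sub>M N)"
  shows "(\<integral>\<^sup>+\<omega>. H (\<omega>, V \<omega>) \<partial>P) = (\<integral>\<^sup>+\<omega>. \<integral>\<^sup>+v. H (\<omega>, v) \<partial>distr P N V \<partial>P)"
proof -
  \<comment> \<open>Independence is grouped into two blocks, \<open>I\<close> and the single source
    \<open>s\<close>, which are disjoint because \<open>s\<close> lies outside
    \<open>I\<close>.\<close>
  have "indep_sets (\<lambda>j. sigma_sets (space P) (\<Union>i\<in>case_bool I {s} j. source_events i)) UNIV"
  proof (rule indep_sets_collect_sigma)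
    show "indep_sets source_events (\<Union>j\<in>UNIV. case_bool I {s} j)"
      by (rule indep_sets_mono_index[OF _ indep_source_events]) simp
    show "disjoint_family_on (case_bool I {s}) UNIV"
      using V(3) by (simp add: disjoint_family_on_def split: bool.split)
  qed (rule Int_stable_source_events)
  then have "indep_sets (case_bool (generated_events P (\<lambda>\<omega>. \<omega>) (info I)) (generated_events P V N)) UNIV"
  proof (rule indep_sets_mono_sets)
    fix j :: bool
    have "A \<in> sets (info I) \<Longrightarrow> A \<inter> space P = A" for A
      using sets.sets_into_space[of A "info I"] by auto
    then show "case_bool (generated_events P (\<lambda>\<omega>. \<omega>) (info I)) (generated_events P V N) j
        \<subseteq> sigma_sets (space P) (\<Union>i\<in>case_bool I {s} j. source_events i)"
      using V(2)
      by (cases j) (fastforce simp: generated_events_def sets_info intro: sigma_sets.Basic)+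
  qed
  then have "indep_set (generated_events P (\<lambda>\<omega>. \<omega>) (info I)) (generated_events P V N)"
    unfolding indep_set_def .
  moreover have "(\<lambda>\<omega>. \<omega>) \<in> measurable P (info I)"
    by (rule measurable_info_imp) (rule measurable_ident_sets[OF refl])
  ultimately show ?thesis
    using nn_integral_indep_pair[where U = "\<lambda>\<omega>. \<omega>", OF _ V(1) _ H] by blast
qed

end

section \<open>Thinning by marks and boresights\<close>

lemma measure_uniform_boresights:
  assumes "0 < \<phi>" "\<phi> \<le> 2 * pi" "v \<noteq> 0"
  shows "measure (uniform_measure lborel {0..<2 * pi}) {\<theta>. in_cone \<phi> \<theta> v} = \<phi> / (2 * pi)"
proof -
  have "emeasure (uniform_measure lborel {0..<2 * pi}) {\<theta>. in_cone \<phi> \<theta> v} = ennreal \<phi> / ennreal (2 * pi)"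
    by (subst emeasure_uniform_measure) (auto simp: emeasure_boresights[OF assms])
  then show ?thesis
    using assms(1) by (simp add: measure_def divide_ennreal)
qed

lemma transmits_in_iff:
  assumes "k < M"
  shows "transmits_in M k slot \<longleftrightarrow> k = slot mod M"
proof
  assume "k = slot mod M"
  then have "slot = k + slot div M * M" by simp
  then show "transmits_in M k slot" unfolding transmits_in_def by blast
qed (use assms in \<open>auto simp: transmits_in_def\<close>)

text \<open>Whatever the slot, exactly one of the \<open>M\<close> marks has its residue.\<close>

lemma measure_uniform_marks:
  assumes "0 < M"
  shows "measure (measure_pmf (pmf_of_set {..<M})) {k. transmits_in M k slot} = 1 / real M"
proof -
  have "{..<M} \<inter> {k. transmits_in M k slot} = {slot mod M}"
    using assms by (auto simp: transmits_in_iff)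
  then show ?thesis
    using assms by (subst measure_pmf_of_set) auto
qed

context radar_network
begin

text \<open>\<open>G\<close> stands for everything already determined without the mark and boresight
  of point \<open>i\<close>, such as the factors of other points. Given position and receiver
  boresight, the two remaining conditions are independent with probabilities \<open>1 / M\<close>
  and \<open>\<phi> / (2 * pi)\<close>.\<close>

lemma nn_integral_thin_point:
  assumes \<phi>: "0 < \<phi>" "\<phi> \<le> 2 * pi" and "0 < M"
    and I: "Points \<in> I" "Receiver_Boresight \<in> I" "Mark i \<notin> I" "Boresight i \<notin> I"
    and G: "G \<in> borel_measurable (info I)"
  shows "(\<integral>\<^sup>+\<omega>. G \<omega> * (if x i \<omega> \<in> sector \<phi> R (b0 \<omega>) \<and> transmits_in M (m i \<omega>) slot \<and>
            in_cone \<phi> (b i \<omega>) (- x i \<omega>) then 0 else 1) \<partial>P) =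
    (\<integral>\<^sup>+\<omega>. G \<omega> * (if x i \<omega> \<in> sector \<phi> R (b0 \<omega>)
        then ennreal (1 - \<phi> / (2 * pi * real M)) else 1) \<partial>P)"
proof -
  \<comment> \<open>The boresight is averaged first, while the mark still counts as known.\<close>
  let ?J = "insert (Mark i) I"
  let ?U = "uniform_measure lborel {0..<2 * pi} :: real measure"
  interpret U: prob_space ?U
    by (rule prob_space_uniform_measure) auto
  have [measurable]: "x i \<in> borel_measurable (info I)" "x i \<in> borel_measurable (info ?J)"
    "b0 \<in> borel_measurable (info I)" "b0 \<in> borel_measurable (info ?J)"
    "m i \<in> measurable (info ?J) (count_space UNIV)"
    "G \<in> borel_measurable (info I)" "G \<in> borel_measurable (info ?J)"
    using I G by (auto intro: points_measurable_info boresight0_measurable_info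
        mark_measurable_info measurable_info_mono)
  have "(\<integral>\<^sup>+\<omega>. G \<omega> * (if x i \<omega> \<in> sector \<phi> R (b0 \<omega>) \<and> transmits_in M (m i \<omega>) slot \<and>
            in_cone \<phi> (b i \<omega>) (- x i \<omega>) then 0 else 1) \<partial>P) =
      (\<integral>\<^sup>+\<omega>. \<integral>\<^sup>+\<theta>. G \<omega> * (if x i \<omega> \<in> sector \<phi> R (b0 \<omega>) \<and> transmits_in M (m i \<omega>) slot \<and>
            in_cone \<phi> \<theta> (- x i \<omega>) then 0 else 1) \<partial>distr P borel (b i) \<partial>P)"
    using nn_integral_source[OF boresight_measurable[of i], where s = "Boresight i" and I = ?J
        and H = "\<lambda>(\<omega>, \<theta>). G \<omega> * (if x i \<omega> \<in> sector \<phi> R (b0 \<omega>) \<and>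
            transmits_in M (m i \<omega>) slot \<and> in_cone \<phi> \<theta> (- x i \<omega>) then 0 else 1)"] I
    by (simp add: source_events_def)
  also have "\<dots> = (\<integral>\<^sup>+\<omega>. G \<omega> * (if x i \<omega> \<in> sector \<phi> R (b0 \<omega>) \<and> transmits_in M (m i \<omega>) slot
        then ennreal (1 - \<phi> / (2 * pi)) else 1) \<partial>P)"
  proof (intro nn_integral_cong)
    fix \<omega>
    let ?d = "x i \<omega> \<in> sector \<phi> R (b0 \<omega>) \<and> transmits_in M (m i \<omega>) slot"
    have "(\<integral>\<^sup>+\<theta>. G \<omega> * (if ?d \<and> in_cone \<phi> \<theta> (- x i \<omega>) then ennreal (1 - 1) else 1) \<partial>?U) =
        G \<omega> * (if ?d then ennreal (1 - 1 * measure ?U {\<theta> \<in> space ?U. in_cone \<phi> \<theta> (- x i \<omega>)}) else 1)"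
      by (rule U.nn_integral_mult_if_one) simp_all
    also have "\<dots> = G \<omega> * (if ?d then ennreal (1 - \<phi> / (2 * pi)) else 1)"
      \<comment> \<open>The probability is the same at every point of the sector; the excluded
        origin is the only exception.\<close>
      using measure_uniform_boresights[OF \<phi>, of "- x i \<omega>"] by (auto simp: sector_def)
    finally show "(\<integral>\<^sup>+\<theta>. G \<omega> * (if x i \<omega> \<in> sector \<phi> R (b0 \<omega>) \<and> transmits_in M (m i \<omega>) slot \<and>
            in_cone \<phi> \<theta> (- x i \<omega>) then 0 else 1) \<partial>distr P borel (b i)) =
        G \<omega> * (if ?d then ennreal (1 - \<phi> / (2 * pi)) else 1)"
      by (simp only: boresight_uniform conj_assoc diff_self ennreal_0)
  qed
  also have "\<dots> = (\<integral>\<^sup>+\<omega>. \<integral>\<^sup>+k. G \<omega> * (if x i \<omega> \<in> sector \<phi> R (b0 \<omega>) \<and> transmits_in M k slot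
        then ennreal (1 - \<phi> / (2 * pi)) else 1) \<partial>distr P (count_space UNIV) (m i) \<partial>P)"
    using nn_integral_source[OF mark_measurable[of i], where s = "Mark i" and I = I
        and H = "\<lambda>(\<omega>, k). G \<omega> * (if x i \<omega> \<in> sector \<phi> R (b0 \<omega>) \<and> transmits_in M k slot
            then ennreal (1 - \<phi> / (2 * pi)) else 1)"] I
    by (simp add: source_events_def)
  also have "\<dots> = (\<integral>\<^sup>+\<omega>. G \<omega> * (if x i \<omega> \<in> sector \<phi> R (b0 \<omega>)
        then ennreal (1 - \<phi> / (2 * pi * real M)) else 1) \<partial>P)"
  proof (intro nn_integral_cong)
    fix \<omega>
    have "\<phi> / (2 * pi) \<le> 1" using \<phi> by simp
    from measure_pmf.nn_integral_mult_if_one[OF _ this, where M = "pmf_of_set {..<M}"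
        and p = "\<lambda>k. transmits_in M k slot" and c = "G \<omega>" and d = "x i \<omega> \<in> sector \<phi> R (b0 \<omega>)"]
    show "(\<integral>\<^sup>+k. G \<omega> * (if x i \<omega> \<in> sector \<phi> R (b0 \<omega>) \<and> transmits_in M k slot
        then ennreal (1 - \<phi> / (2 * pi)) else 1) \<partial>distr P (count_space UNIV) (m i)) =
      G \<omega> * (if x i \<omega> \<in> sector \<phi> R (b0 \<omega>) then ennreal (1 - \<phi> / (2 * pi * real M)) else 1)"
      unfolding mark_uniform by (simp add: measure_uniform_marks[OF \<open>0 < M\<close>])
  qed
  finally show ?thesis .
qed

text \<open>Once averaged, the factor of the last point depends only on positions and receiver
  boresight. It can therefore be absorbed into \<open>G\<close>, which is why the induction keeps
  \<open>G\<close> arbitrary.\<close>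

lemma nn_integral_thin_points:
  assumes \<phi>: "0 < \<phi>" "\<phi> \<le> 2 * pi" and "0 < M"
    and G: "G \<in> borel_measurable (info {Points, Receiver_Boresight})"
  shows "(\<integral>\<^sup>+\<omega>. G \<omega> * (\<Prod>i<n. if x i \<omega> \<in> sector \<phi> R (b0 \<omega>) \<and> transmits_in M (m i \<omega>) slot \<and>
            in_cone \<phi> (b i \<omega>) (- x i \<omega>) then 0 else 1) \<partial>P) =
    (\<integral>\<^sup>+\<omega>. G \<omega> * (\<Prod>i<n. if x i \<omega> \<in> sector \<phi> R (b0 \<omega>)
        then ennreal (1 - \<phi> / (2 * pi * real M)) else 1) \<partial>P)"
  using G
proof (induction n arbitrary: G)
  case 0
  then show ?case by simp
next
  case (Suc n)
  let ?c = "ennreal (1 - \<phi> / (2 * pi * real M))"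
  let ?hit = "\<lambda>i \<omega>. x i \<omega> \<in> sector \<phi> R (b0 \<omega>) \<and> transmits_in M (m i \<omega>) slot \<and>
            in_cone \<phi> (b i \<omega>) (- x i \<omega>)"
  let ?K = "{Points, Receiver_Boresight}"
  \<comment> \<open>These sources determine the factors of the points before \<open>n\<close>, and
    contain neither the mark nor the boresight of point \<open>n\<close>.\<close>
  let ?I = "?K \<union> Mark ` {..<n} \<union> Boresight ` {..<n}"
  have [measurable]: "x i \<in> borel_measurable (info ?I)" "b0 \<in> borel_measurable (info ?I)"
    "x i \<in> borel_measurable (info ?K)" "b0 \<in> borel_measurable (info ?K)"
    "G \<in> borel_measurable (info ?K)" "G \<in> borel_measurable (info ?I)" for i
    using Suc.prems by (auto intro: points_measurable_info boresight0_measurable_info measurable_info_mono)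
  have hit: "Measurable.pred (info ?I) (?hit i)" if "i < n" for i
  proof -
    have [measurable]: "m i \<in> measurable (info ?I) (count_space UNIV)" "b i \<in> borel_measurable (info ?I)"
      using that by (auto intro: mark_measurable_info boresight_measurable_info)
    show ?thesis by measurable
  qed
  have "(\<lambda>\<omega>. \<Prod>i<n. if ?hit i \<omega> then 0 else 1 :: ennreal) \<in> borel_measurable (info ?I)"
    by (intro borel_measurable_prod_ennreal measurable_If measurable_const hit[unfolded pred_def]) simp_all
  have "(\<integral>\<^sup>+\<omega>. G \<omega> * (\<Prod>i<Suc n. if ?hit i \<omega> then 0 else 1) \<partial>P) =
      (\<integral>\<^sup>+\<omega>. G \<omega> * (\<Prod>i<n. if ?hit i \<omega> then 0 else 1) * (if ?hit n \<omega> then 0 else 1) \<partial>P)"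
    by (simp only: prod.lessThan_Suc mult.assoc)
  also have "\<dots> = (\<integral>\<^sup>+\<omega>. G \<omega> * (\<Prod>i<n. if ?hit i \<omega> then 0 else 1) *
      (if x n \<omega> \<in> sector \<phi> R (b0 \<omega>) then ?c else 1) \<partial>P)"
  proof (rule nn_integral_thin_point[OF \<phi> \<open>0 < M\<close>])
    show "(\<lambda>\<omega>. G \<omega> * (\<Prod>i<n. if ?hit i \<omega> then 0 else 1)) \<in> borel_measurable (info ?I)"
      by (rule borel_measurable_times_ennreal) fact+
  qed auto
  also have "\<dots> = (\<integral>\<^sup>+\<omega>. (G \<omega> * (if x n \<omega> \<in> sector \<phi> R (b0 \<omega>) then ?c else 1)) *
      (\<Prod>i<n. if ?hit i \<omega> then 0 else 1) \<partial>P)"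
    by (simp only: mult_ac)
  also have "\<dots> = (\<integral>\<^sup>+\<omega>. (G \<omega> * (if x n \<omega> \<in> sector \<phi> R (b0 \<omega>) then ?c else 1)) *
      (\<Prod>i<n. if x i \<omega> \<in> sector \<phi> R (b0 \<omega>) then ?c else 1) \<partial>P)"
    by (rule Suc.IH) measurable
  also have "\<dots> = (\<integral>\<^sup>+\<omega>. G \<omega> * (\<Prod>i<Suc n. if x i \<omega> \<in> sector \<phi> R (b0 \<omega>) then ?c else 1) \<partial>P)"
    by (simp only: prod.lessThan_Suc mult_ac)
  finally show ?case .
qed

lemma prob_no_interferer_in_sector:
  assumes \<phi>: "0 < \<phi>" "\<phi> \<le> 2 * pi" and "0 < M" "0 < R" "0 \<le> lam"
  shows "prob {\<omega> \<in> space P. \<forall>i. \<not> (x i \<omega> \<in> sector \<phi> R (b0 \<omega>) \<and> transmits_in M (m i \<omega>) slot \<and>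
            in_cone \<phi> (b i \<omega>) (- x i \<omega>))} =
    exp (- (lam * \<phi>\<^sup>2 * R\<^sup>2 / (4 * pi * real M)))"
proof -
  let ?q = "\<phi> / (2 * pi * real M)"
  let ?hit = "\<lambda>i \<omega>. x i \<omega> \<in> sector \<phi> R (b0 \<omega>) \<and> transmits_in M (m i \<omega>) slot \<and>
            in_cone \<phi> (b i \<omega>) (- x i \<omega>)"
  let ?thin = "\<lambda>n \<theta> \<omega>. \<Prod>i<n. if x i \<omega> \<in> sector \<phi> R \<theta> then ennreal (1 - ?q) else 1"
  let ?p = "exp (- (lam * \<phi>\<^sup>2 * R\<^sup>2 / (4 * pi * real M)))"
  let ?D = "distr P borel b0"
  have "\<phi> \<le> 2 * pi * 1" using \<phi> by simp
  also have "\<dots> \<le> 2 * pi * real M" using \<open>0 < M\<close> by (intro mult_left_mono) auto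
  finally have q: "0 \<le> ?q" "?q \<le> 1" using \<phi> \<open>0 < M\<close> by auto
  note [measurable] = points_measurable boresight0_measurable mark_measurable boresight_measurable
  have [measurable]: "x i \<in> borel_measurable (info {Points})" for i
    by (rule points_measurable_info) simp
  interpret D: prob_space ?D by (rule prob_space_distr) simp
  have D1: "emeasure ?D UNIV = 1" using D.emeasure_space_1 by simp
  interpret PD: pair_sigma_finite P ?D ..
  have hit_prod: "(\<Prod>i<n. if ?hit i \<omega> then 0 else 1 :: ennreal) = (if \<forall>i<n. \<not> ?hit i \<omega> then 1 else 0)"
    for n \<omega>
  proof (cases "\<forall>i<n. \<not> ?hit i \<omega>")
    case True
    then have "(\<Prod>i<n. if ?hit i \<omega> then 0 else 1 :: ennreal) = 1"
      by (intro prod.neutral) auto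
    then show ?thesis by (simp only: if_P[OF True])
  next
    case False
    then have "(\<Prod>i<n. if ?hit i \<omega> then 0 else 1 :: ennreal) = 0"
      by (intro prod_zero) auto
    then show ?thesis by (simp only: if_not_P[OF False])
  qed
  have lim: "(\<lambda>n. \<integral>\<^sup>+\<omega>. (\<Prod>i<n. if ?hit i \<omega> then 0 else 1) \<partial>P)
      \<longlonglongrightarrow> (\<integral>\<^sup>+\<omega>. indicator {\<omega> \<in> space P. \<forall>i. \<not> ?hit i \<omega>} \<omega> \<partial>P)"
  proof (rule nn_integral_dominated_convergence[where w = "\<lambda>_. 1"])
    show "AE \<omega> in P. (\<Prod>i<n. if ?hit i \<omega> then 0 else 1 :: ennreal) \<le> 1" for n
      unfolding hit_prod by (rule AE_I2) simp
    show "AE \<omega> in P. (\<lambda>n. \<Prod>i<n. if ?hit i \<omega> then 0 else 1)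
        \<longlonglongrightarrow> (indicator {\<omega> \<in> space P. \<forall>i. \<not> ?hit i \<omega>} \<omega> :: ennreal)"
    proof (rule AE_I2)
      fix \<omega> assume "\<omega> \<in> space P"
      \<comment> \<open>If some index is a hit, its successor serves as \<open>k\<close>; otherwise
        any \<open>k\<close> does.\<close>
      obtain k where k: "(\<forall>i<n. \<not> ?hit i \<omega>) \<longleftrightarrow> (\<forall>i. \<not> ?hit i \<omega>)" if "k \<le> n" for n
        by (meson Suc_le_eq less_le_trans)
      have "(\<Prod>i<n. if ?hit i \<omega> then 0 else 1) =
          (indicator {\<omega> \<in> space P. \<forall>i. \<not> ?hit i \<omega>} \<omega> :: ennreal)" if "k \<le> n" for n
        unfolding hit_prod k[OF that] using \<open>\<omega> \<in> space P\<close> by (simp add: indicator_def)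
      then have "\<forall>\<^sub>F n in sequentially. (\<Prod>i<n. if ?hit i \<omega> then 0 else 1) =
          (indicator {\<omega> \<in> space P. \<forall>i. \<not> ?hit i \<omega>} \<omega> :: ennreal)"
        unfolding eventually_sequentially by blast
      then show "(\<lambda>n. \<Prod>i<n. if ?hit i \<omega> then 0 else 1)
          \<longlonglongrightarrow> (indicator {\<omega> \<in> space P. \<forall>i. \<not> ?hit i \<omega>} \<omega> :: ennreal)"
        by (rule tendsto_eventually)
    qed
  qed (simp_all add: emeasure_space_1)
  \<comment> \<open>After thinning only positions and receiver boresight remain. Taking the
    boresight integral outermost leaves a deterministic sector inside.\<close>
  have eq: "(\<integral>\<^sup>+\<omega>. (\<Prod>i<n. if ?hit i \<omega> then 0 else 1) \<partial>P) = (\<integral>\<^sup>+\<theta>. \<integral>\<^sup>+\<omega>. ?thin n \<theta> \<omega> \<partial>P \<partial>?D)" for n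
  proof -
    have "(\<integral>\<^sup>+\<omega>. (\<Prod>i<n. if ?hit i \<omega> then 0 else 1) \<partial>P) = (\<integral>\<^sup>+\<omega>. ?thin n (b0 \<omega>) \<omega> \<partial>P)"
      using nn_integral_thin_points[OF \<phi> \<open>0 < M\<close> measurable_const[of 1],
          where n = n and R = R and slot = slot] by (simp only: mult_1 space_borel UNIV_I)
    also have "\<dots> = (\<integral>\<^sup>+\<omega>. \<integral>\<^sup>+\<theta>. ?thin n \<theta> \<omega> \<partial>?D \<partial>P)"
      using nn_integral_source[OF boresight0_measurable, where s = Receiver_Boresight and I = "{Points}"
          and H = "\<lambda>(\<omega>, \<theta>). ?thin n \<theta> \<omega>"]
      by (simp add: source_events_def)
    also have "\<dots> = (\<integral>\<^sup>+\<theta>. \<integral>\<^sup>+\<omega>. ?thin n \<theta> \<omega> \<partial>P \<partial>?D)"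
      by (rule PD.Fubini'[symmetric]) measurable
    finally show ?thesis .
  qed
  have "(\<lambda>n. \<integral>\<^sup>+\<theta>. \<integral>\<^sup>+\<omega>. ?thin n \<theta> \<omega> \<partial>P \<partial>?D) \<longlonglongrightarrow> (\<integral>\<^sup>+\<theta>. ennreal ?p \<partial>?D)"
  proof (rule nn_integral_dominated_convergence[where w = "\<lambda>_. 1"])
    have "(\<integral>\<^sup>+\<omega>. ?thin n \<theta> \<omega> \<partial>P) \<le> (\<integral>\<^sup>+\<omega>. 1 \<partial>P)" for n \<theta>
      using q by (intro nn_integral_mono prod_le_1) auto
    then show "AE \<theta> in ?D. (\<integral>\<^sup>+\<omega>. ?thin n \<theta> \<omega> \<partial>P) \<le> 1" for n
      by (simp add: emeasure_space_1)
    have "(\<lambda>n. \<integral>\<^sup>+\<omega>. ?thin n \<theta> \<omega> \<partial>P) \<longlonglongrightarrow> ennreal ?p" for \<theta>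
    proof -
      \<comment> \<open>One factor \<open>\<phi>\<close> comes from the interferer boresight through
        \<open>?q\<close>, the other from the area of the receiving sector.\<close>
      have *: "(1 - (1 - ?q)) * lam * measure lborel (sector \<phi> R \<theta>) = lam * \<phi>\<^sup>2 * R\<^sup>2 / (4 * pi * real M)"
        by (simp add: measure_sector[OF \<phi> \<open>0 < R\<close>] power2_eq_square ac_simps)
      show ?thesis
        using poisson_product_limit[OF points \<open>0 \<le> lam\<close> _ _ sector_borel bounded_sector, of "1 - ?q"] q
        unfolding *[symmetric] by simp
    qed
    then show "AE \<theta> in ?D. (\<lambda>n. \<integral>\<^sup>+\<omega>. ?thin n \<theta> \<omega> \<partial>P) \<longlonglongrightarrow> ennreal ?p" by simp
  qed (simp_all add: D1)
  then have "(\<integral>\<^sup>+\<omega>. indicator {\<omega> \<in> space P. \<forall>i. \<not> ?hit i \<omega>} \<omega> \<partial>P) = (\<integral>\<^sup>+\<theta>. ennreal ?p \<partial>?D)"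
    by (rule LIMSEQ_unique[OF lim[unfolded eq]])
  then have "emeasure P {\<omega> \<in> space P. \<forall>i. \<not> ?hit i \<omega>} = ennreal ?p"
    by (simp add: D1)
  then show ?thesis by (simp add: measure_def)
qed

end

section \<open>Strongest interferer and critical distance\<close>

text \<open>The radius is the distance at which an interferer seen with full gain on both sides
  delivers exactly \<open>\<Theta>\<close>. If either beam misses, the power is 0 and hence below
  the threshold.\<close>

lemma received_power_le_iff:
  assumes \<phi>: "0 < \<phi>" "\<phi> \<le> 2 * pi" and pos: "0 < \<alpha>" "0 < Pt" "0 < Gm" "0 < l" "0 < \<Theta>"
  shows "received_power Pt Gm l \<alpha> \<phi> \<theta>0 y \<theta> \<le> \<Theta> \<longleftrightarrow>
    \<not> (y \<in> sector \<phi> ((Pt * Gm\<^sup>2 * l / \<Theta>) powr (1 / \<alpha>)) \<theta>0 \<and> in_cone \<phi> \<theta> (- y))"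
proof -
  let ?K = "Pt * Gm\<^sup>2 * l"
  define R where "R = (?K / \<Theta>) powr (1 / \<alpha>)"
  have K: "0 < ?K" using pos by simp
  then have R: "0 < R" "R powr \<alpha> = ?K / \<Theta>"
    using pos by (simp_all add: R_def powr_powr)
  have *: "Pt * Gm * Gm * l * norm y powr (- \<alpha>) \<le> \<Theta> \<longleftrightarrow> R \<le> norm y" if "y \<noteq> 0"
  proof -
    have "Pt * Gm * Gm * l = ?K" by (simp add: power2_eq_square)
    then have "Pt * Gm * Gm * l * norm y powr (- \<alpha>) \<le> \<Theta> \<longleftrightarrow> ?K * norm y powr (- \<alpha>) \<le> \<Theta>"
      by (simp only:)
    also have "\<dots> \<longleftrightarrow> R powr \<alpha> \<le> norm y powr \<alpha>"
      using that pos by (simp add: R(2) powr_minus field_simps)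
    also have "\<dots> \<longleftrightarrow> R \<le> norm y"
      using R(1) pos(1) powr_mono2[of \<alpha> R "norm y"] powr_less_mono2[of \<alpha> "norm y" R] by force
    finally show ?thesis .
  qed
  show ?thesis
    using pos unfolding received_power_def cone_gain_def beam_iff_inner[OF \<phi>] R_def[symmetric]
    by (cases "y = 0") (auto simp: sector_def not_less *)
qed

lemma strongest_interference_le_iff:
  assumes "0 < \<phi>" "\<phi> \<le> 2 * pi" "0 < \<alpha>" "0 < Pt" "0 < Gm" "0 < l" "0 < \<Theta>"
  shows "strongest_interference Pt Gm l \<alpha> \<phi> M x m b b0 slot \<omega> \<le> ennreal \<Theta> \<longleftrightarrow>
    (\<forall>i. \<not> (x i \<omega> \<in> sector \<phi> ((Pt * Gm\<^sup>2 * l / \<Theta>) powr (1 / \<alpha>)) (b0 \<omega>) \<and>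
       transmits_in M (m i \<omega>) slot \<and> in_cone \<phi> (b i \<omega>) (- x i \<omega>)))"
  using \<open>0 < \<Theta>\<close> received_power_le_iff[OF assms]
  unfolding strongest_interference_def SUP_le_iff by (auto simp: ennreal_le_iff)

lemma (in radar_network) prob_strongest_interference_at_most:
  assumes "0 < \<phi>" "\<phi> \<le> 2 * pi" "0 < \<alpha>" "0 < Pt" "0 < Gm" "0 < l" "0 < \<Theta>" "0 < M" "0 \<le> lam"
  shows "prob_at_most P (strongest_interference Pt Gm l \<alpha> \<phi> M x m b b0 slot) \<Theta> =
    exp (- (lam * \<phi>\<^sup>2 * ((Pt * Gm\<^sup>2 * l / \<Theta>) powr (1 / \<alpha>))\<^sup>2 / (4 * pi * real M)))"
  unfolding prob_at_most_def strongest_interference_le_iff[OF assms(1-7)]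
  using assms by (intro prob_no_interferer_in_sector) auto

text \<open>Dividing the echo constant by \<open>\<Theta>\<close> leaves
  \<open>\<kappa> * \<sigma> / (4 * pi)\<close> times the power \<open>\<alpha>\<close> of the
  interference radius. The root of order \<open>2 * \<alpha>\<close> turns the latter into the
  square root of that radius.\<close>

lemma is_critical_distance_iff:
  assumes pos: "0 < \<alpha>" "0 < Pt" "0 < Gm" "0 < l" "0 < \<kappa>" "0 < \<sigma>" "0 < \<Theta>"
  shows "is_critical_distance (echo_power Pt Gm \<kappa> \<sigma> l \<alpha>) \<Theta> d \<longleftrightarrow>
    d = (\<kappa> * \<sigma> / (4 * pi)) powr (1 / (2 * \<alpha>)) * ((Pt * Gm\<^sup>2 * l / \<Theta>) powr (1 / \<alpha>)) powr (1 / 2)"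
    (is "_ \<longleftrightarrow> d = ?D")
proof -
  let ?C = "Pt * Gm\<^sup>2 * \<kappa> * \<sigma> * l / (4 * pi)"
  have "0 < ?C / \<Theta>" using pos by simp
  have "?D = (\<kappa> * \<sigma> / (4 * pi) * (Pt * Gm\<^sup>2 * l / \<Theta>)) powr (1 / (2 * \<alpha>))"
    using pos by (simp only: powr_mult powr_powr) (simp add: mult.commute)
  also have "\<kappa> * \<sigma> / (4 * pi) * (Pt * Gm\<^sup>2 * l / \<Theta>) = ?C / \<Theta>" by simp
  finally have D: "?D = (?C / \<Theta>) powr (1 / (2 * \<alpha>))" .
  have "?C * d powr (- 2 * \<alpha>) = \<Theta> \<longleftrightarrow> d powr (2 * \<alpha>) = ?C / \<Theta>" if "d > 0"
  proof -
    have *: "d powr (- 2 * \<alpha>) = 1 / d powr (2 * \<alpha>)"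
      by (simp add: powr_minus_divide)
    have "c * (1 / y) = \<Theta> \<longleftrightarrow> y = c / \<Theta>" if "y > 0" for c y
      using that pos(7) by (auto simp: field_simps)
    from this[of "d powr (2 * \<alpha>)" ?C] show ?thesis
      unfolding * using \<open>d > 0\<close> by simp
  qed
  moreover have "d powr (2 * \<alpha>) = ?C / \<Theta> \<longleftrightarrow> d = (?C / \<Theta>) powr (1 / (2 * \<alpha>))" if "d > 0"
  proof
    assume "d powr (2 * \<alpha>) = ?C / \<Theta>"
    then have "(?C / \<Theta>) powr (1 / (2 * \<alpha>)) = (d powr (2 * \<alpha>)) powr (1 / (2 * \<alpha>))" by simp
    then show "d = (?C / \<Theta>) powr (1 / (2 * \<alpha>))"
      using that pos(1) by (simp add: powr_powr)
  next
    assume "d = (?C / \<Theta>) powr (1 / (2 * \<alpha>))"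
    then have "d powr (2 * \<alpha>) = ((?C / \<Theta>) powr (1 / (2 * \<alpha>))) powr (2 * \<alpha>)" by simp
    also have "\<dots> = ?C / \<Theta>"
    proof -
      have "1 / (2 * \<alpha>) * (2 * \<alpha>) = 1" using pos(1) by simp
      then show ?thesis
        by (simp only: powr_powr powr_one[OF less_imp_le[OF \<open>0 < ?C / \<Theta>\<close>]])
    qed
    finally show "d powr (2 * \<alpha>) = ?C / \<Theta>" .
  qed
  moreover have "0 < (?C / \<Theta>) powr (1 / (2 * \<alpha>))" using pos by simp
  ultimately show ?thesis
    unfolding is_critical_distance_def echo_power_def D by metis
qed

theorem mainTheorem3:
  fixes P :: "'w measure"
    and x :: "nat \<Rightarrow> 'w \<Rightarrow> real ^ 2"
    and m :: "nat \<Rightarrow> 'w \<Rightarrow> nat"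
    and b :: "nat \<Rightarrow> 'w \<Rightarrow> real"
    and b0 :: "'w \<Rightarrow> real"
    and M own_mark slot :: nat
    and lam \<delta> \<phi> \<alpha> Pt Gm l \<kappa> \<sigma> Pfa \<Theta> d :: real
  assumes "lam > 0" and "M \<ge> 2" and "\<delta> = 1 / real M"
    and "0 < \<phi>" and "\<phi> \<le> 2 * pi" and "\<alpha> > 2"
    and "Pt > 0" and "Gm > 0" and "l > 0" and "\<kappa> > 0" and "\<sigma> > 0"
    and "0 < Pfa" and "Pfa < 1"
    and network: "radar_network P lam M x m b b0"
    and detection_slot: "own_mark < M" "\<not> transmits_in M own_mark slot"
    and "\<Theta> > 0"
    and threshold:
      "Pfa = 1 - prob_at_most P (strongest_interference Pt Gm l \<alpha> \<phi> M x m b b0 slot) \<Theta> ^ (M - 1)"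
  shows "is_critical_distance (echo_power Pt Gm \<kappa> \<sigma> l \<alpha>) \<Theta> d \<longleftrightarrow>
         d = (\<kappa> * \<sigma> / (4 * pi)) powr (1 / (2 * \<alpha>)) *
             (- 4 * pi * ln (1 - Pfa) / ((1 - \<delta>) * lam * \<phi>\<^sup>2)) powr (1 / 4)"
proof -
  interpret radar_network P lam M x m b b0 by (rule network)
  define R where "R = (Pt * Gm\<^sup>2 * l / \<Theta>) powr (1 / \<alpha>)"
  have R: "0 < R" using assms by (simp add: R_def)
  have M: "real (M - 1) = real M - 1" "0 < real M - 1"
    using \<open>M \<ge> 2\<close> by auto
  have "1 - Pfa = exp (- (lam * \<phi>\<^sup>2 * R\<^sup>2 / (4 * pi * real M))) ^ (M - 1)"
    using threshold prob_strongest_interference_at_most[of \<phi> \<alpha> Pt Gm l \<Theta> slot] assms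
    by (simp add: R_def)
  also have "\<dots> = exp (real (M - 1) * - (lam * \<phi>\<^sup>2 * R\<^sup>2 / (4 * pi * real M)))"
    by (rule exp_of_nat_mult[symmetric])
  finally have "ln (1 - Pfa) = (real M - 1) * - (lam * \<phi>\<^sup>2 * R\<^sup>2 / (4 * pi * real M))"
    by (simp only: ln_exp M(1))
  \<comment> \<open>The power \<open>M - 1\<close> over the detection slots and the activity
    \<open>1 / M\<close> combine to the factor \<open>1 - \<delta>\<close>.\<close>
  then have "- 4 * pi * ln (1 - Pfa) = ((real M - 1) / real M) * lam * \<phi>\<^sup>2 * R\<^sup>2"
    by simp
  moreover have "1 - \<delta> = (real M - 1) / real M"
    using \<open>M \<ge> 2\<close> by (simp add: \<open>\<delta> = 1 / real M\<close> diff_divide_distrib)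
  moreover have "(real M - 1) / real M * lam * \<phi>\<^sup>2 \<noteq> 0"
    using M \<open>M \<ge> 2\<close> \<open>lam > 0\<close> \<open>0 < \<phi>\<close> by simp
  ultimately have "- 4 * pi * ln (1 - Pfa) / ((1 - \<delta>) * lam * \<phi>\<^sup>2) = R\<^sup>2"
    by simp
  \<comment> \<open>The bracket of the claim is the square of the radius, while the critical
    distance contains its square root.\<close>
  moreover have "(R\<^sup>2) powr (1 / 4) = R powr (1 / 2)"
    using R by (simp add: powr_powr flip: powr_numeral)
  ultimately show ?thesis
    using is_critical_distance_iff[of \<alpha> Pt Gm l \<kappa> \<sigma> \<Theta> d] assms by (simp add: R_def)
qed

end
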